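(* Let $\Gamma=(A_1,A_2,\mathbf{u})$ be a finite two-player normal-form game and let $\bm{\sigma}=(\sigma_1,\sigma_2)\in\Delta(A_1)\times\Delta(A_2)$ be a strategy profile for $\Gamma$. For $i=1,2$ let $\mathcal{A}_i$ be a set of diff-based policies for Player $i$ with $\mathcal{A}_i\supseteq\bar{\mathcal{A}}_i$, where $\bar{\mathcal{A}}_i$ is the set of all threshold policies of Player $i$. Then the following two statements are equivalent: (1) There is a policy difference function $\mathrm{diff}$ for $(\mathcal{A}_1,\mathcal{A}_2)$ such that there is a Nash equilibrium $(\pi_1,\pi_2)$ of the diff meta game $(\Gamma,\mathcal{A}_1,\mathcal{A}_2,\mathrm{diff})$ such that $(\pi_1,\pi_2)$ plays $\bm{\sigma}$. (2) The strategy profile $\bm{\sigma}$ is individually rational. The result continues to hold if one restricts attention to deterministic functions $\mathrm{diff}$ with $\mathrm{diff}_1=\mathrm{diff}_2$ and $\mathrm{diff}_i(\pi_1,\pi_2)\in\{0,1\}$ for $i=1,2$.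
   Context: A two-player normal-form game $\Gamma=(A_1,A_2,\mathbf{u})$ has action sets $A_1,A_2$ and utility function $\mathbf{u}=(u_1,u_2)\colon A_1\times A_2\to\mathbb{R}^2$, extended to mixed strategies in $\Delta(A_1)\times\Delta(A_2)$ by taking expectations. $-i$ denotes the player other than $i$. The profile $\bm{\sigma}$ is individually rational if each player's payoff is at least her minimax payoff, i.e. $u_i(\bm{\sigma})\geq \min_{\sigma'_{-i}\in\Delta(A_{-i})}\max_{a_i\in A_i}u_i(a_i,\sigma'_{-i})$ for $i=1,2$. A diff-based policy for Player $i$ is a function $\pi\colon\mathbb{R}\to\Delta(A_i)$. A threshold policy $(\sigma_i^{\leqslant},\theta,\sigma_i^{>})$, with $\theta\in\mathbb{R}\cup\{-\infty,\infty\}$ and $\sigma_i^{\leqslant},\sigma_i^{>}\in\Delta(A_i)$, is the policy $\pi$ with $\pi(d)=\sigma_i^{\leqslant}$ if $d\leq\theta$ and $\pi(d)=\sigma_i^{>}$ otherwise. A policy difference function for $(\mathcal{A}_1,\mathcal{A}_2)$ is a stochastic function $\mathrm{diff}=(\mathrm{diff}_1,\mathrm{diff}_2)$ from $\mathcal{A}_1\times\mathcal{A}_2$ to $\mathbb{R}^2$ (i.e. it assigns to each pair of policies an $\mathbb{R}^2$-valued random variable). The pair $(\pi_1,\pi_2)$ plays the profile $\bm{\sigma}$ if $\sigma_i=\mathbb{E}[\pi_i(\mathrm{diff}_i(\pi_1,\pi_2))]$ for $i=1,2$. The diff meta game $(\Gamma,\mathcal{A}_1,\mathcal{A}_2,\mathrm{diff})$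 is the normal-form game with strategy sets $\mathcal{A}_1,\mathcal{A}_2$ and payoffs $V(\pi_1,\pi_2)=\mathbb{E}\big[\mathbf{u}(\pi_1(\mathrm{diff}_1(\pi_1,\pi_2)),\pi_2(\mathrm{diff}_2(\pi_1,\pi_2)))\big]$. Nash equilibria of the meta game are pairs $(\pi_1,\pi_2)\in\mathcal{A}_1\times\mathcal{A}_2$ from which neither player can profitably deviate within $\mathcal{A}_i$.
   Formalization: In (1), for general stochastic diff, the players' actions under the equilibrium pair are also required to be independent; without this (1) does not imply (2), since diff may correlate play while "plays σ" fixes only marginals. The deterministic version needs no such condition. *)

theory Defs
  imports "HOL-Probability.Probability"
begin

definition mixed :: "'a set \<Rightarrow> 'a pmf set" where
  "mixed A = {s. set_pmf s \<subseteq> A}"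

definition payoff :: "('a \<times> 'b \<Rightarrow> real \<times> real) \<Rightarrow> 'a pmf \<Rightarrow> 'b pmf \<Rightarrow> real \<times> real" where
  "payoff u s1 s2 = measure_pmf.expectation (pair_pmf s1 s2) u"

text \<open>For finite nonempty action sets the infimum over the (compact) set of mixed strategies
  is attained, so it is the minimum in the definition of the minimax payoff.\<close>

definition minimax1 :: "'a set \<Rightarrow> 'b set \<Rightarrow> ('a \<times> 'b \<Rightarrow> real \<times> real) \<Rightarrow> real" where
  "minimax1 A1 A2 u = (INF s2\<in>mixed A2. MAX a\<in>A1. fst (payoff u (return_pmf a) s2))"

definition minimax2 :: "'a set \<Rightarrow> 'b set \<Rightarrow> ('a \<times> 'b \<Rightarrow> real \<times> real) \<Rightarrow> real" where
  "minimax2 A1 A2 u = (INF s1\<in>mixed A1. MAX b\<in>A2. snd (payoff u s1 (return_pmf b)))"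

definition individually_rational ::
    "'a set \<Rightarrow> 'b set \<Rightarrow> ('a \<times> 'b \<Rightarrow> real \<times> real) \<Rightarrow> 'a pmf \<Rightarrow> 'b pmf \<Rightarrow> bool" where
  "individually_rational A1 A2 u s1 s2 \<longleftrightarrow>
     fst (payoff u s1 s2) \<ge> minimax1 A1 A2 u \<and> snd (payoff u s1 s2) \<ge> minimax2 A1 A2 u"

type_synonym 'a policy = "real \<Rightarrow> 'a pmf"

definition policies :: "'a set \<Rightarrow> 'a policy set" where
  "policies A = {\<pi>. \<forall>d. \<pi> d \<in> mixed A}"

definition threshold_policy :: "'a pmf \<Rightarrow> ereal \<Rightarrow> 'a pmf \<Rightarrow> 'a policy" where
  "threshold_policy s \<theta> s' = (\<lambda>d. if ereal d \<le> \<theta> then s else s')"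

definition threshold_policies :: "'a set \<Rightarrow> 'a policy set" where
  "threshold_policies A = {threshold_policy s \<theta> s' | s \<theta> s'. s \<in> mixed A \<and> s' \<in> mixed A}"

text \<open>A stochastic function is given by the law \<open>D \<pi>1 \<pi>2\<close> of the random vector
  \<open>(diff1(\<pi>1, \<pi>2), diff2(\<pi>1, \<pi>2))\<close>.\<close>

type_synonym ('a, 'b) diff_fun = "'a policy \<Rightarrow> 'b policy \<Rightarrow> (real \<times> real) measure"

text \<open>A random vector \<open>X\<close> on a probability space induces a probability measure on the
  sigma-algebra of all \<open>S\<close> whose preimage under \<open>X\<close> is an event. This sigma-algebra contains the
  Borel sets, but may be larger. Allowing for that, policies that are not Borel measurable are not
  excluded: the requirement is only that the mixed strategies \<open>\<pi>1(diff1)\<close> and \<open>\<pi>2(diff2)\<close>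
  are random variables, so that the expectations below exist.\<close>

definition policy_diff_fun :: "'a policy set \<Rightarrow> 'b policy set \<Rightarrow> ('a, 'b) diff_fun \<Rightarrow> bool" where
  "policy_diff_fun P1 P2 D \<longleftrightarrow>
     (\<forall>\<pi>1\<in>P1. \<forall>\<pi>2\<in>P2.
        prob_space (D \<pi>1 \<pi>2) \<and> space (D \<pi>1 \<pi>2) = UNIV \<and>
        (\<lambda>d. d) \<in> borel_measurable (D \<pi>1 \<pi>2) \<and>
        (\<forall>a. (\<lambda>d. pmf (\<pi>1 (fst d)) a) \<in> borel_measurable (D \<pi>1 \<pi>2)) \<and>
        (\<forall>b. (\<lambda>d. pmf (\<pi>2 (snd d)) b) \<in> borel_measurable (D \<pi>1 \<pi>2)))"

definition deterministic :: "'a policy set \<Rightarrow> 'b policy set \<Rightarrow> ('a, 'b) diff_fun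
    \<Rightarrow> ('a policy \<Rightarrow> 'b policy \<Rightarrow> real \<times> real) \<Rightarrow> bool" where
  "deterministic P1 P2 D f \<longleftrightarrow>
     (\<forall>\<pi>1\<in>P1. \<forall>\<pi>2\<in>P2. D \<pi>1 \<pi>2 = return (count_space UNIV) (f \<pi>1 \<pi>2))"

definition plays ::
    "('a, 'b) diff_fun \<Rightarrow> 'a policy \<Rightarrow> 'b policy \<Rightarrow> 'a pmf \<Rightarrow> 'b pmf \<Rightarrow> bool" where
  "plays D \<pi>1 \<pi>2 s1 s2 \<longleftrightarrow>
     (\<forall>a. pmf s1 a = (\<integral>d. pmf (\<pi>1 (fst d)) a \<partial>D \<pi>1 \<pi>2)) \<and>
     (\<forall>b. pmf s2 b = (\<integral>d. pmf (\<pi>2 (snd d)) b \<partial>D \<pi>1 \<pi>2))"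

text \<open>The players randomise independently given \<open>(diff1, diff2)\<close>. The condition below says that
  their actions are then also unconditionally independent. It holds whenever the random mixed
  strategies \<open>\<pi>1(diff1)\<close> and \<open>\<pi>2(diff2)\<close> are independent, in particular for deterministic
  \<open>diff\<close>. If it fails, \<open>diff\<close> acts as a correlation device, and the payoff of a pair that plays
  \<open>s1\<close>, \<open>s2\<close> in the sense of the marginals need not be the payoff of the profile
  \<open>(s1, s2)\<close>.\<close>

definition independent_play :: "('a, 'b) diff_fun \<Rightarrow> 'a policy \<Rightarrow> 'b policy \<Rightarrow> bool" where
  "independent_play D \<pi>1 \<pi>2 \<longleftrightarrow>
     (\<forall>a b. (\<integral>d. pmf (\<pi>1 (fst d)) a * pmf (\<pi>2 (snd d)) b \<partial>D \<pi>1 \<pi>2) =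
        (\<integral>d. pmf (\<pi>1 (fst d)) a \<partial>D \<pi>1 \<pi>2) * (\<integral>d. pmf (\<pi>2 (snd d)) b \<partial>D \<pi>1 \<pi>2))"

definition meta_payoff :: "('a \<times> 'b \<Rightarrow> real \<times> real) \<Rightarrow> ('a, 'b) diff_fun
    \<Rightarrow> 'a policy \<Rightarrow> 'b policy \<Rightarrow> real \<times> real" where
  "meta_payoff u D \<pi>1 \<pi>2 = (\<integral>d. payoff u (\<pi>1 (fst d)) (\<pi>2 (snd d)) \<partial>D \<pi>1 \<pi>2)"

definition meta_nash :: "('a \<times> 'b \<Rightarrow> real \<times> real) \<Rightarrow> 'a policy set \<Rightarrow> 'b policy set
    \<Rightarrow> ('a, 'b) diff_fun \<Rightarrow> 'a policy \<Rightarrow> 'b policy \<Rightarrow> bool" where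
  "meta_nash u P1 P2 D \<pi>1 \<pi>2 \<longleftrightarrow> \<pi>1 \<in> P1 \<and> \<pi>2 \<in> P2 \<and>
     (\<forall>\<pi>1'\<in>P1. fst (meta_payoff u D \<pi>1' \<pi>2) \<le> fst (meta_payoff u D \<pi>1 \<pi>2)) \<and>
     (\<forall>\<pi>2'\<in>P2. snd (meta_payoff u D \<pi>1 \<pi>2') \<le> snd (meta_payoff u D \<pi>1 \<pi>2))"

end

theory Submission
  imports Defs
begin

text \<open>If \<open>\<sigma>\<close> is individually rational, let \<open>diff\<close> detect whether the pair of policies is a fixed pair
  of threshold policies that play \<open>\<sigma>\<^sub>i\<close> on \<open>0\<close> and a minimax punishment on \<open>1\<close>. Conversely, a
  deviation to a constant policy can provoke a reaction of the opponent that depends on the constant,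
  so the equilibrium condition bounds the maximin value, and the minimax theorem is needed. We prove
  it by Blackwell's argument: against the maximizer's strategy proportional to the positive parts of
  the regrets, mixing the opponent's reaction into his current strategy with weight \<open>1/(n + 2)\<close>
  drives the squared positive regret down to \<open>C/(n + 2)\<close>.\<close>

section \<open>Mixed strategies on finite sets\<close>

lemma mixed_exists_of_weights:
  fixes w :: "'b \<Rightarrow> real"
  assumes "finite B" and "\<And>b. b \<in> B \<Longrightarrow> 0 \<le> w b" and "sum w B = 1"
  shows "\<exists>q\<in>mixed B. \<forall>b\<in>B. pmf q b = w b"
proof -
  \<comment> \<open>Extension by zero outside \<open>B\<close> gives the support condition and turns
    the total mass over the whole type into the finite sum.\<close>
  define f where "f b = (if b \<in> B then w b else 0)" for b
  have nonneg: "0 \<le> f b" for b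
    using assms(2) by (simp add: f_def)
  have "(\<integral>\<^sup>+b. ennreal (f b) \<partial>count_space UNIV) = (\<Sum>b\<in>B. ennreal (f b))"
    using assms(1) by (intro nn_integral_count_space') (auto simp: f_def)
  also have "\<dots> = ennreal (\<Sum>b\<in>B. f b)"
    using nonneg by (simp add: sum_ennreal)
  also have "(\<Sum>b\<in>B. f b) = 1"
    using assms(3) by (simp add: f_def)
  finally have total: "(\<integral>\<^sup>+b. ennreal (f b) \<partial>count_space UNIV) = 1"
    by simp
  have "pmf (embed_pmf f) b = f b" for b
    using nonneg total by (rule pmf_embed_pmf)
  then show ?thesis
    by (intro bexI[of _ "embed_pmf f"]) (auto simp: mixed_def set_pmf_eq f_def)
qed

lemma mixed_sum_pmf:
  "finite B \<Longrightarrow> q \<in> mixed B \<Longrightarrow> (\<Sum>b\<in>B. pmf q b) = 1"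
  by (simp add: mixed_def sum_pmf_eq_1)

lemma return_pmf_mixed [simp]: "return_pmf b \<in> mixed B \<longleftrightarrow> b \<in> B"
  by (simp add: mixed_def)

lemma mixed_nonempty: "q \<in> mixed B \<Longrightarrow> B \<noteq> {}"
  using set_pmf_not_empty[of q] by (auto simp: mixed_def)

text \<open>Strategies are viewed through their weight functions, with the product topology on
  functions to the reals. They form the closed slice of total weight 1 in a Tychonoff product of
  compact sets; the factor \<open>{0}\<close> outside \<open>B\<close> encodes the support, so the
  action type may be infinite.\<close>

lemma compact_pmf_mixed:
  assumes "finite B"
  shows "compact (pmf ` mixed B)"
proof -
  define K :: "('a \<Rightarrow> real) set" where "K = Pi\<^sub>E UNIV (\<lambda>b. if b \<in> B then {0..1} else {0})"
  have "compactin (product_topology (\<lambda>_. euclidean) UNIV) K"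
    unfolding K_def by (subst compactin_PiE) auto
  then have "compact K"
    by (simp add: euclidean_product_topology)
  have "closed {w :: 'a \<Rightarrow> real. sum w B = 1}"
    by (intro closed_Collect_eq continuous_on_sum continuous_intros) auto
  have "pmf ` mixed B = K \<inter> {w. sum w B = 1}"
  proof (intro equalityI subsetI)
    fix w assume "w \<in> pmf ` mixed B"
    then obtain q where "q \<in> mixed B" "w = pmf q" by auto
    then show "w \<in> K \<inter> {w. sum w B = 1}"
      using mixed_sum_pmf[OF assms] by (auto simp: K_def mixed_def pmf_le_1 pmf_eq_0_set_pmf)
  next
    fix w assume w: "w \<in> K \<inter> {w. sum w B = 1}"
    then have range: "w b \<in> (if b \<in> B then {0..1} else {0})" for b
      by (auto simp: K_def PiE_iff)
    then have "0 \<le> w b" for b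
      by (metis atLeastAtMost_iff order_refl singletonD)
    then obtain q where q: "q \<in> mixed B" "\<And>b. b \<in> B \<Longrightarrow> pmf q b = w b"
      using mixed_exists_of_weights[OF assms, of w] w by auto
    have "pmf q b = w b" for b
      using q range[of b] by (cases "b \<in> B") (auto simp: mixed_def pmf_eq_0_set_pmf)
    then have "w = pmf q" by auto
    with q(1) show "w \<in> pmf ` mixed B" by blast
  qed
  with compact_Int_closed[OF \<open>compact K\<close> \<open>closed _\<close>] show ?thesis by simp
qed

section \<open>The minimax value\<close>

text \<open>The maximizer chooses from \<open>A\<close> and the opponent from \<open>B\<close>. This
  scalar game serves both players: for Player 2 the two sets are exchanged. Finite sums make the
  linearity in the weights explicit.\<close>

definition pure_payoff :: "'b set \<Rightarrow> ('a \<Rightarrow> 'b \<Rightarrow> real) \<Rightarrow> 'b pmf \<Rightarrow> 'a \<Rightarrow> real" where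
  "pure_payoff B v q a = (\<Sum>b\<in>B. pmf q b * v a b)"

definition mixed_payoff ::
    "'a set \<Rightarrow> 'b set \<Rightarrow> ('a \<Rightarrow> 'b \<Rightarrow> real) \<Rightarrow> 'a pmf \<Rightarrow> 'b pmf \<Rightarrow> real" where
  "mixed_payoff A B v p q = (\<Sum>a\<in>A. pmf p a * pure_payoff B v q a)"

definition minimax :: "'a set \<Rightarrow> 'b set \<Rightarrow> ('a \<Rightarrow> 'b \<Rightarrow> real) \<Rightarrow> real" where
  "minimax A B v = (INF q\<in>mixed B. MAX a\<in>A. pure_payoff B v q a)"

lemma abs_pure_payoff_le: "\<bar>pure_payoff B v q a\<bar> \<le> (\<Sum>b\<in>B. \<bar>v a b\<bar>)"
  unfolding pure_payoff_def
proof (rule order_trans[OF sum_abs sum_mono])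
  fix b
  show "\<bar>pmf q b * v a b\<bar> \<le> \<bar>v a b\<bar>"
    using mult_right_mono[OF pmf_le_1, of "\<bar>v a b\<bar>" q b] by (simp add: abs_mult)
qed

lemma minimax_le_Max:
  assumes "finite A" "A \<noteq> {}" "q \<in> mixed B"
  shows "minimax A B v \<le> (MAX a\<in>A. pure_payoff B v q a)"
proof -
  obtain a where "a \<in> A" using assms by blast
  \<comment> \<open>A real infimum is a lower bound only for a family bounded below. One fixed
    action of the maximizer supplies a bound uniform in the opponent's strategy.\<close>
  have "- (\<Sum>b\<in>B. \<bar>v a b\<bar>) \<le> (MAX a\<in>A. pure_payoff B v r a)" for r
  proof -
    have "- (\<Sum>b\<in>B. \<bar>v a b\<bar>) \<le> pure_payoff B v r a"
      using abs_pure_payoff_le[of B v r a] by linarith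
    also have "\<dots> \<le> (MAX a\<in>A. pure_payoff B v r a)"
      using assms(1) \<open>a \<in> A\<close> by simp
    finally show ?thesis .
  qed
  then show ?thesis
    unfolding minimax_def by (intro cINF_lower[OF bdd_belowI2 assms(3)])
qed

section \<open>Existence of minimax strategies\<close>

lemma continuous_on_Max_image:
  fixes f :: "'i \<Rightarrow> 'x::topological_space \<Rightarrow> real"
  assumes "finite A" "A \<noteq> {}" "\<And>a. a \<in> A \<Longrightarrow> continuous_on S (f a)"
  shows "continuous_on S (\<lambda>x. MAX a\<in>A. f a x)"
  using assms
proof (induction A rule: finite_ne_induct)
  case (insert a A)
  then have "continuous_on S (\<lambda>x. max (f a x) (MAX a\<in>A. f a x))"
    by (intro continuous_on_max) auto
  then show ?case using insert by simp
qed simp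

text \<open>A maximum of finitely many linear functions of the weights is continuous, so it attains
  its infimum on the compact set of weight functions. The minimizer later serves as the
  punishment.\<close>

lemma minimax_attained:
  assumes "finite A" "A \<noteq> {}" "finite B" "B \<noteq> {}"
  shows "\<exists>q\<in>mixed B. \<forall>a\<in>A. pure_payoff B v q a \<le> minimax A B v"
proof -
  define F where "F w = (MAX a\<in>A. \<Sum>b\<in>B. w b * v a b)" for w
  have "continuous_on (pmf ` mixed B) F"
    unfolding F_def using assms(1,2)
    by (intro continuous_on_Max_image continuous_intros
        continuous_on_subset[OF continuous_on_product_coordinates subset_UNIV])
  moreover obtain b where "b \<in> B" using assms by blast
  then have ne: "mixed B \<noteq> {}"
    using return_pmf_mixed[of b B] by blast
  ultimately obtain q where q: "q \<in> mixed B" "\<And>q'. q' \<in> mixed B \<Longrightarrow> F (pmf q) \<le> F (pmf q')"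
    using continuous_attains_inf[OF compact_pmf_mixed[OF assms(3)], of F] by auto
  have "F (pmf q) \<le> minimax A B v"
    unfolding minimax_def
    by (rule cINF_greatest[OF ne]) (use q in \<open>auto simp: F_def pure_payoff_def\<close>)
  moreover have "pure_payoff B v q a \<le> F (pmf q)" if "a \<in> A" for a
    unfolding F_def using assms(1) that by (auto simp: pure_payoff_def)
  ultimately show ?thesis
    using q(1) order_trans by blast
qed

section \<open>The minimax theorem by Blackwell's argument\<close>

lemma mixed_payoff_le:
  assumes "finite A" "p \<in> mixed A" "\<And>a. a \<in> A \<Longrightarrow> pure_payoff B v q a \<le> V"
  shows "mixed_payoff A B v p q \<le> V"
proof -
  have "mixed_payoff A B v p q \<le> (\<Sum>a\<in>A. pmf p a * V)"
    unfolding mixed_payoff_def using assms(3) by (intro sum_mono mult_left_mono) auto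
  also have "\<dots> = V"
    using assms by (simp flip: sum_distrib_right add: mixed_sum_pmf)
  finally show ?thesis .
qed

lemma mixed_convex:
  fixes l :: real
  assumes "finite B" "q \<in> mixed B" "q' \<in> mixed B" "0 \<le> l" "l \<le> 1"
  shows "\<exists>r\<in>mixed B. \<forall>a. pure_payoff B v r a
    = (1 - l) * pure_payoff B v q a + l * pure_payoff B v q' a"
proof -
  have "(\<Sum>b\<in>B. (1 - l) * pmf q b + l * pmf q' b) = 1"
    using assms by (simp add: sum.distrib mixed_sum_pmf flip: sum_distrib_left)
  then obtain r where r: "r \<in> mixed B" "\<forall>b\<in>B. pmf r b = (1 - l) * pmf q b + l * pmf q' b"
    using mixed_exists_of_weights[OF assms(1), of "\<lambda>b. (1 - l) * pmf q b + l * pmf q' b"] assms(4,5)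
    by auto
  have "pure_payoff B v r a = (1 - l) * pure_payoff B v q a + l * pure_payoff B v q' a" for a
    unfolding pure_payoff_def sum_distrib_left sum.distrib[symmetric]
    using r(2) by (intro sum.cong) (auto simp: distrib_right mult.assoc)
  with r(1) show ?thesis by blast
qed

text \<open>The opponent may answer after seeing \<open>p\<close>, yet the result is one
  \<open>q\<close> that nearly works against all actions at once. \<open>C\<close> bounds the
  squared norm of the regret vector of every strategy; it starts the induction and controls the
  second-order term of each step.\<close>

lemma regret_bound:
  assumes "finite A" "finite B" "B \<noteq> {}"
    and response: "\<And>p. p \<in> mixed A \<Longrightarrow> \<exists>q\<in>mixed B. mixed_payoff A B v p q \<le> V"
    and C: "C = (\<Sum>a\<in>A. ((\<Sum>b\<in>B. \<bar>v a b\<bar>) + \<bar>V\<bar>)\<^sup>2)"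
  shows "\<exists>q\<in>mixed B. (\<Sum>a\<in>A. (max 0 (pure_payoff B v q a - V))\<^sup>2) \<le> C / (real n + 1)"
proof (induction n)
  define g where "g q a = pure_payoff B v q a - V" for q a
  have bound: "(g q a)\<^sup>2 \<le> ((\<Sum>b\<in>B. \<bar>v a b\<bar>) + \<bar>V\<bar>)\<^sup>2" for q a
    using abs_pure_payoff_le[of B v q a] by (intro power2_le_iff_abs_le[THEN iffD2])
      (auto simp: g_def intro: add_nonneg_nonneg sum_nonneg)
  have C_bound: "(\<Sum>a\<in>A. (g q a)\<^sup>2) \<le> C" for q
    unfolding C by (intro sum_mono bound)
  {
    case 0
    obtain b where "b \<in> B" using assms by blast
    have "(\<Sum>a\<in>A. (max 0 (g (return_pmf b) a))\<^sup>2) \<le> (\<Sum>a\<in>A. (g (return_pmf b) a)\<^sup>2)"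
      by (intro sum_mono) (auto simp: max_def)
    also note C_bound
    finally show ?case
      using \<open>b \<in> B\<close> by (intro bexI[of _ "return_pmf b"]) (auto simp: g_def)
  next
    case (Suc n)
    then obtain q where q: "q \<in> mixed B" "(\<Sum>a\<in>A. (max 0 (g q a))\<^sup>2) \<le> C / (real n + 1)"
      by (auto simp: g_def)
    define S where "S = (\<Sum>a\<in>A. max 0 (g q a))"
    have "S \<ge> 0"
      unfolding S_def by (simp add: sum_nonneg)
    have C_nonneg: "0 \<le> C"
      unfolding C by (simp add: sum_nonneg)
    show ?case
    \<comment> \<open>With no positive regret, \<open>q\<close> itself remains good enough;
      otherwise \<open>S\<close> normalizes the positive parts to a strategy.\<close>
    proof (cases "S = 0")
      case True
      then have "\<forall>a\<in>A. max 0 (g q a) = 0"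
        unfolding S_def using assms(1) by (subst (asm) sum_nonneg_eq_0_iff) auto
      then have "(\<Sum>a\<in>A. (max 0 (g q a))\<^sup>2) = 0"
        by simp
      then show ?thesis
        using q(1) C_nonneg by (intro bexI[of _ q]) (auto simp: g_def)
    next
      case False
      with \<open>S \<ge> 0\<close> have "S > 0" by simp
      have "(\<Sum>a\<in>A. max 0 (g q a) / S) = 1"
        using False by (simp add: S_def flip: sum_divide_distrib)
      then obtain p where p: "p \<in> mixed A" "\<forall>a\<in>A. pmf p a = max 0 (g q a) / S"
        using mixed_exists_of_weights[OF assms(1), of "\<lambda>a. max 0 (g q a) / S"] \<open>S > 0\<close> by auto
      obtain q' where q': "q' \<in> mixed B" "mixed_payoff A B v p q' \<le> V"
        using response[OF p(1)] by blast
      \<comment> \<open>The choice of \<open>p\<close> makes this inner product equal to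
        \<open>S\<close> times the regret of the response against \<open>p\<close>. Hence the regret
        vector of \<open>q'\<close> makes no acute angle with the positive part of that of
        \<open>q\<close>.\<close>
      have "(\<Sum>a\<in>A. max 0 (g q a) * g q' a) = S * (\<Sum>a\<in>A. pmf p a * g q' a)"
        using p(2) False by (simp add: sum_distrib_left)
      also have "(\<Sum>a\<in>A. pmf p a * g q' a) = mixed_payoff A B v p q' - (\<Sum>a\<in>A. pmf p a) * V"
        by (simp add: g_def mixed_payoff_def algebra_simps sum_subtractf sum_distrib_left)
      also have "\<dots> \<le> 0"
        using q'(2) p(1) assms(1) by (simp add: mixed_sum_pmf)
      finally have cross: "(\<Sum>a\<in>A. max 0 (g q a) * g q' a) \<le> 0"
        using \<open>S > 0\<close> by (simp add: mult_nonneg_nonpos)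
      \<comment> \<open>This weight closes the recursion exactly:
        \<open>(1 - l)^2 * C / (n + 1) + l^2 * C = C / (n + 2)\<close>.\<close>
      define l where "l = 1 / (real n + 2)"
      have l: "0 \<le> l" "l \<le> 1"
        by (auto simp: l_def)
      obtain r where r: "r \<in> mixed B" "\<And>a. pure_payoff B v r a
          = (1 - l) * pure_payoff B v q a + l * pure_payoff B v q' a"
        using mixed_convex[OF assms(2) q(1) q'(1) l] by blast
      have g_r: "g r a = (1 - l) * g q a + l * g q' a" for a
        by (simp add: g_def r(2) algebra_simps)
      \<comment> \<open>Replacing the old regret by its positive part only increases the mixture.
        Squaring is monotone where \<open>g r a\<close> is positive, and elsewhere the left side
        vanishes.\<close>
      have "(max 0 (g r a))\<^sup>2 \<le> ((1 - l) * max 0 (g q a) + l * g q' a)\<^sup>2" for a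
      proof (cases "g r a \<le> 0")
        case False
        have "g r a \<le> (1 - l) * max 0 (g q a) + l * g q' a"
          unfolding g_r using l by (intro add_right_mono mult_left_mono) auto
        with False show ?thesis
          by (intro power_mono) auto
      qed simp
      then have "(\<Sum>a\<in>A. (max 0 (g r a))\<^sup>2)
          \<le> (\<Sum>a\<in>A. ((1 - l) * max 0 (g q a) + l * g q' a)\<^sup>2)"
        by (intro sum_mono)
      also have "\<dots> = (1 - l)\<^sup>2 * (\<Sum>a\<in>A. (max 0 (g q a))\<^sup>2)
          + 2 * l * (1 - l) * (\<Sum>a\<in>A. max 0 (g q a) * g q' a) + l\<^sup>2 * (\<Sum>a\<in>A. (g q' a)\<^sup>2)"
        unfolding sum_distrib_left sum.distrib[symmetric]
        by (intro sum.cong) (auto simp: power2_eq_square algebra_simps)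
      also have "\<dots> \<le> (1 - l)\<^sup>2 * (C / (real n + 1)) + 0 + l\<^sup>2 * C"
        using q(2) l cross C_bound[of q']
        by (intro add_mono mult_left_mono mult_nonneg_nonpos) auto
      also have "\<dots> = C / (real (Suc n) + 1)"
        by (simp add: l_def divide_simps) (simp add: power2_eq_square algebra_simps)
      finally show ?thesis
        using r(1) by (auto simp: g_def)
    qed
  }
qed

text \<open>This is the hard inequality of the minimax theorem. If the value exceeded
  \<open>V\<close>, every \<open>q\<close> would have some regret at least as large as the gap,
  whereas \<open>regret_bound\<close> produces strategies with arbitrarily small positive
  regrets.\<close>

theorem minimax_le_maximin_bound:
  assumes "finite A" "A \<noteq> {}" "finite B" "B \<noteq> {}"
    and response: "\<And>p. p \<in> mixed A \<Longrightarrow> \<exists>q\<in>mixed B. mixed_payoff A B v p q \<le> V"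
  shows "minimax A B v \<le> V"
proof (rule ccontr)
  assume gt: "\<not> minimax A B v \<le> V"
  then have pos: "0 < (minimax A B v - V)\<^sup>2" by simp
  define C where "C = (\<Sum>a\<in>A. ((\<Sum>b\<in>B. \<bar>v a b\<bar>) + \<bar>V\<bar>)\<^sup>2)"
  obtain n :: nat where n: "C / (minimax A B v - V)\<^sup>2 < real n"
    using reals_Archimedean2 by blast
  obtain q where q: "q \<in> mixed B"
    "(\<Sum>a\<in>A. (max 0 (pure_payoff B v q a - V))\<^sup>2) \<le> C / (real n + 1)"
    using regret_bound[OF assms(1,3,4) response C_def] by blast
  obtain a where a: "a \<in> A" "(MAX a\<in>A. pure_payoff B v q a) = pure_payoff B v q a"
    using Max_in[of "pure_payoff B v q ` A"] assms(1,2) by (metis finite_imageI image_iff image_is_empty)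
  have "minimax A B v \<le> pure_payoff B v q a"
    using minimax_le_Max[OF assms(1,2) q(1), of v] a(2) by simp
  then have "(minimax A B v - V)\<^sup>2 \<le> (max 0 (pure_payoff B v q a - V))\<^sup>2"
    using gt by (intro power_mono) auto
  also have "\<dots> \<le> (\<Sum>a\<in>A. (max 0 (pure_payoff B v q a - V))\<^sup>2)"
    using a(1) assms(1) by (intro member_le_sum) auto
  also note q(2)
  finally have "(real n + 1) * (minimax A B v - V)\<^sup>2 \<le> C"
    by (simp add: field_simps)
  moreover have "C < real n * (minimax A B v - V)\<^sup>2"
    using n pos by (simp add: field_simps)
  ultimately show False
    using pos by (simp add: algebra_simps)
qed

section \<open>Payoffs of the game and of the meta game\<close>

lemma payoff_eq_sum:
  assumes "finite A" "finite B" "p \<in> mixed A" "q \<in> mixed B"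
  shows "payoff u p q = (\<Sum>a\<in>A. \<Sum>b\<in>B. (pmf p a * pmf q b) *\<^sub>R u (a, b))"
proof -
  have "payoff u p q = (\<Sum>x\<in>A \<times> B. pmf (pair_pmf p q) x *\<^sub>R u x)"
    unfolding payoff_def using assms by (intro integral_measure_pmf) (auto simp: mixed_def)
  also have "\<dots> = (\<Sum>a\<in>A. \<Sum>b\<in>B. (pmf p a * pmf q b) *\<^sub>R u (a, b))"
    by (simp add: sum.cartesian_product case_prod_unfold flip: pmf_pair)
  finally show ?thesis .
qed

lemma fst_payoff:
  assumes "finite A" "finite B" "p \<in> mixed A" "q \<in> mixed B"
  shows "fst (payoff u p q) = mixed_payoff A B (\<lambda>a b. fst (u (a, b))) p q"
  by (simp add: payoff_eq_sum[OF assms] fst_sum mixed_payoff_def pure_payoff_def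
      sum_distrib_left mult.assoc)

lemma snd_payoff:
  assumes "finite A" "finite B" "p \<in> mixed A" "q \<in> mixed B"
  shows "snd (payoff u p q) = mixed_payoff B A (\<lambda>b a. snd (u (a, b))) q p"
  by (subst payoff_eq_sum[OF assms], subst sum.swap)
    (simp add: snd_sum mixed_payoff_def pure_payoff_def sum_distrib_left mult_ac)

lemma mixed_payoff_return:
  assumes "finite A" "a \<in> A"
  shows "mixed_payoff A B v (return_pmf a) q = pure_payoff B v q a"
proof -
  have "mixed_payoff A B v (return_pmf a) q = (\<Sum>x\<in>A. if a = x then pure_payoff B v q x else 0)"
    unfolding mixed_payoff_def by (intro sum.cong) (auto simp: pmf_return)
  then show ?thesis using assms by simp
qed

lemma minimax1_eq:
  assumes "finite A" "finite B"
  shows "minimax1 A B u = minimax A B (\<lambda>a b. fst (u (a, b)))"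
  unfolding minimax1_def minimax_def using assms
  by (intro INF_cong refl arg_cong[where f = Max] image_cong)
    (simp_all add: fst_payoff mixed_payoff_return)

lemma minimax2_eq:
  assumes "finite A" "finite B"
  shows "minimax2 A B u = minimax B A (\<lambda>b a. snd (u (a, b)))"
  unfolding minimax2_def minimax_def using assms
  by (intro INF_cong refl arg_cong[where f = Max] image_cong)
    (simp_all add: snd_payoff mixed_payoff_return)

text \<open>A threshold policy with equal strategies on both sides is constant. These are the
  deviations that force individual rationality.\<close>

lemma const_policy_threshold: "p \<in> mixed A \<Longrightarrow> (\<lambda>_. p) \<in> threshold_policies A"
  unfolding threshold_policies_def threshold_policy_def by force

text \<open>This averages the reaction of an opponent to a deviation into a single mixed strategy.
  Weights lie in [0, 1], so they are integrable, and the finite sum commutes with the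
  integral.\<close>

lemma mean_strategy_exists:
  assumes "prob_space M" "finite B" "\<And>x. s x \<in> mixed B"
    and meas: "\<And>b. (\<lambda>x. pmf (s x) b) \<in> borel_measurable M"
  shows "\<exists>q\<in>mixed B. \<forall>b\<in>B. pmf q b = (\<integral>x. pmf (s x) b \<partial>M)"
proof (rule mixed_exists_of_weights[OF assms(2)])
  interpret prob_space M by fact
  have "integrable M (\<lambda>x. pmf (s x) b)" for b
    by (rule integrable_const_bound[where B = 1]) (auto simp: meas pmf_le_1)
  then have "(\<Sum>b\<in>B. \<integral>x. pmf (s x) b \<partial>M) = (\<integral>x. (\<Sum>b\<in>B. pmf (s x) b) \<partial>M)"
    by simp
  also have "\<dots> = 1"
    using assms(2,3) by (simp add: mixed_sum_pmf prob_space)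
  finally show "(\<Sum>b\<in>B. \<integral>x. pmf (s x) b \<partial>M) = 1" .
qed simp

text \<open>The law of \<open>diff\<close> enters the payoffs only through the joint probabilities
  of action pairs. These factor into marginals under independent play, and also when one policy is
  constant.\<close>

lemma meta_payoff_eq_sum:
  assumes "finite A" "finite B" "P1 \<subseteq> policies A" "P2 \<subseteq> policies B"
    and "policy_diff_fun P1 P2 D" "\<pi>1 \<in> P1" "\<pi>2 \<in> P2"
  shows "meta_payoff u D \<pi>1 \<pi>2 = (\<Sum>a\<in>A. \<Sum>b\<in>B.
    (\<integral>d. pmf (\<pi>1 (fst d)) a * pmf (\<pi>2 (snd d)) b \<partial>D \<pi>1 \<pi>2) *\<^sub>R u (a, b))"
proof -
  interpret prob_space "D \<pi>1 \<pi>2"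
    using assms by (auto simp: policy_diff_fun_def)
  have [measurable]: "(\<lambda>d. pmf (\<pi>1 (fst d)) a) \<in> borel_measurable (D \<pi>1 \<pi>2)"
    "(\<lambda>d. pmf (\<pi>2 (snd d)) b) \<in> borel_measurable (D \<pi>1 \<pi>2)" for a b
    using assms by (auto simp: policy_diff_fun_def)
  have int: "integrable (D \<pi>1 \<pi>2) (\<lambda>d. pmf (\<pi>1 (fst d)) a * pmf (\<pi>2 (snd d)) b)" for a b
    by (rule integrable_const_bound[where B = 1]) (auto simp: pmf_le_1 mult_le_one)
  have "\<pi>1 d \<in> mixed A" "\<pi>2 d \<in> mixed B" for d
    using assms by (auto simp: policies_def)
  then show ?thesis
    unfolding meta_payoff_def using int by (simp add: payoff_eq_sum[OF assms(1,2)])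
qed

section \<open>Equilibria of the meta game\<close>

lemma individually_rational_of_meta_nash:
  assumes fin: "finite A" "finite B" and \<sigma>: "\<sigma>1 \<in> mixed A" "\<sigma>2 \<in> mixed B"
    and P: "P1 \<subseteq> policies A" "P2 \<subseteq> policies B"
    and T: "threshold_policies A \<subseteq> P1" "threshold_policies B \<subseteq> P2"
    and D: "policy_diff_fun P1 P2 D" and nash: "meta_nash u P1 P2 D \<pi>1 \<pi>2"
    and plays: "plays D \<pi>1 \<pi>2 \<sigma>1 \<sigma>2" and indep: "independent_play D \<pi>1 \<pi>2"
  shows "individually_rational A B u \<sigma>1 \<sigma>2"
proof -
  note meta = meta_payoff_eq_sum[OF fin P D]
  have \<pi>: "\<pi>1 \<in> P1" "\<pi>2 \<in> P2"
    using nash by (auto simp: meta_nash_def)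
  have \<pi>_mixed: "\<pi>1 d \<in> mixed A" "\<pi>2 d \<in> mixed B" for d
    using P \<pi> by (auto simp: policies_def)
  have ne: "A \<noteq> {}" "B \<noteq> {}"
    using \<sigma> by (auto dest: mixed_nonempty)
  \<comment> \<open>Independence splits the joint action probabilities into products of marginals,
    which \<open>plays\<close> identifies with the weights of the profile.\<close>
  have eq_value: "meta_payoff u D \<pi>1 \<pi>2 = payoff u \<sigma>1 \<sigma>2"
    using plays indep
    by (simp add: meta[OF \<pi>] payoff_eq_sum[OF fin \<sigma>] plays_def independent_play_def)
  have "minimax A B (\<lambda>a b. fst (u (a, b))) \<le> fst (payoff u \<sigma>1 \<sigma>2)"
  proof (rule minimax_le_maximin_bound[OF fin(1) ne(1) fin(2) ne(2)])
    fix p assume p: "p \<in> mixed A"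
    then have c: "(\<lambda>_. p) \<in> P1"
      using const_policy_threshold T by blast
    \<comment> \<open>\<open>q\<close> is the mean reaction of \<open>\<pi>2\<close> to the constant
      \<open>p\<close>. It may vary with \<open>p\<close> because \<open>diff\<close> sees the
      deviation; this is the response hypothesis of the minimax theorem.\<close>
    obtain q where q: "q \<in> mixed B"
      "\<forall>b\<in>B. pmf q b = (\<integral>d. pmf (\<pi>2 (snd d)) b \<partial>D (\<lambda>_. p) \<pi>2)"
      using mean_strategy_exists[OF _ fin(2), of "D (\<lambda>_. p) \<pi>2" "\<lambda>d. \<pi>2 (snd d)"] D c \<pi> \<pi>_mixed
      by (auto simp: policy_diff_fun_def)
    \<comment> \<open>Against a constant policy the factor \<open>pmf p a\<close> leaves the
      integral, so no correlation can arise.\<close>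
    have "payoff u p q = meta_payoff u D (\<lambda>_. p) \<pi>2"
      unfolding meta[OF c \<pi>(2)] payoff_eq_sum[OF fin p q(1)] using q(2) by simp
    then have "fst (payoff u p q) \<le> fst (payoff u \<sigma>1 \<sigma>2)"
      using nash c eq_value by (auto simp: meta_nash_def)
    then show "\<exists>q\<in>mixed B. mixed_payoff A B (\<lambda>a b. fst (u (a, b))) p q \<le> fst (payoff u \<sigma>1 \<sigma>2)"
      using q(1) by (auto simp: fst_payoff[OF fin p q(1)])
  qed
  moreover have "minimax B A (\<lambda>b a. snd (u (a, b))) \<le> snd (payoff u \<sigma>1 \<sigma>2)"
  proof (rule minimax_le_maximin_bound[OF fin(2) ne(2) fin(1) ne(1)])
    fix q assume q: "q \<in> mixed B"
    then have c: "(\<lambda>_. q) \<in> P2"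
      using const_policy_threshold T by blast
    obtain p where p: "p \<in> mixed A"
      "\<forall>a\<in>A. pmf p a = (\<integral>d. pmf (\<pi>1 (fst d)) a \<partial>D \<pi>1 (\<lambda>_. q))"
      using mean_strategy_exists[OF _ fin(1), of "D \<pi>1 (\<lambda>_. q)" "\<lambda>d. \<pi>1 (fst d)"] D c \<pi> \<pi>_mixed
      by (auto simp: policy_diff_fun_def)
    have "payoff u p q = meta_payoff u D \<pi>1 (\<lambda>_. q)"
      unfolding meta[OF \<pi>(1) c] payoff_eq_sum[OF fin p(1) q] using p(2) by simp
    then have "snd (payoff u p q) \<le> snd (payoff u \<sigma>1 \<sigma>2)"
      using nash c eq_value by (auto simp: meta_nash_def)
    then show "\<exists>p\<in>mixed A. mixed_payoff B A (\<lambda>b a. snd (u (a, b))) q p \<le> snd (payoff u \<sigma>1 \<sigma>2)"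
      using p(1) by (auto simp: snd_payoff[OF fin p(1) q])
  qed
  ultimately show ?thesis
    by (simp add: individually_rational_def minimax1_eq[OF fin] minimax2_eq[OF fin])
qed

section \<open>Equilibria from individually rational profiles\<close>

lemma integral_return_count_space [simp]:
  fixes g :: "'c \<Rightarrow> 'd::{banach, second_countable_topology}"
  shows "(\<integral>x. g x \<partial>return (count_space UNIV) y) = g y"
  by (rule integral_return) auto

lemma deterministic_independent_play:
  assumes "deterministic P1 P2 D f" "\<pi>1 \<in> P1" "\<pi>2 \<in> P2"
  shows "independent_play D \<pi>1 \<pi>2"
  using assms by (simp add: deterministic_def independent_play_def)

lemma meta_nash_of_individually_rational:
  assumes fin: "finite A" "finite B" and \<sigma>: "\<sigma>1 \<in> mixed A" "\<sigma>2 \<in> mixed B"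
    and P: "P1 \<subseteq> policies A" "P2 \<subseteq> policies B"
    and T: "threshold_policies A \<subseteq> P1" "threshold_policies B \<subseteq> P2"
    and ir: "individually_rational A B u \<sigma>1 \<sigma>2"
  shows "\<exists>D f. policy_diff_fun P1 P2 D \<and> deterministic P1 P2 D f \<and>
    (\<forall>\<pi>1 \<pi>2. f \<pi>1 \<pi>2 \<in> {(0, 0), (1, 1)}) \<and>
    (\<exists>\<pi>1 \<pi>2. meta_nash u P1 P2 D \<pi>1 \<pi>2 \<and> plays D \<pi>1 \<pi>2 \<sigma>1 \<sigma>2)"
proof -
  have ne: "A \<noteq> {}" "B \<noteq> {}"
    using \<sigma> by (auto dest: mixed_nonempty)
  \<comment> \<open>\<open>m2\<close> is Player 2's punishment of Player 1, and \<open>m1\<close>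
    below is Player 1's punishment of Player 2.\<close>
  obtain m2 where m2: "m2 \<in> mixed B"
    "\<And>a. a \<in> A \<Longrightarrow> pure_payoff B (\<lambda>a b. fst (u (a, b))) m2 a \<le> minimax1 A B u"
    using minimax_attained[OF fin(1) ne(1) fin(2) ne(2)] unfolding minimax1_eq[OF fin] by blast
  obtain m1 where m1: "m1 \<in> mixed A"
    "\<And>b. b \<in> B \<Longrightarrow> pure_payoff A (\<lambda>b a. snd (u (a, b))) m1 b \<le> minimax2 A B u"
    using minimax_attained[OF fin(2) ne(2) fin(1) ne(1)] unfolding minimax2_eq[OF fin] by blast
  \<comment> \<open>The threshold 0 separates the two values of \<open>diff\<close>: 0 calls for the
    profile and 1 for punishment.\<close>
  define \<tau>1 where "\<tau>1 = threshold_policy \<sigma>1 0 m1"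
  define \<tau>2 where "\<tau>2 = threshold_policy \<sigma>2 0 m2"
  \<comment> \<open>Policies are compared as functions, so even a deviation that agrees with
    \<open>\<tau>1\<close> or \<open>\<tau>2\<close> at 0 and 1 is detected. After a unilateral
    deviation the other player sees 1 and punishes.\<close>
  define f :: "'a policy \<Rightarrow> 'b policy \<Rightarrow> real \<times> real" where
    "f \<pi>1 \<pi>2 = (if \<pi>1 = \<tau>1 \<and> \<pi>2 = \<tau>2 then (0, 0) else (1, 1))" for \<pi>1 \<pi>2
  \<comment> \<open>On \<open>count_space UNIV\<close> every function is measurable, so the point
    mass is admissible for all policies, Borel or not.\<close>
  define D where "D \<pi>1 \<pi>2 = return (count_space UNIV) (f \<pi>1 \<pi>2)" for \<pi>1 \<pi>2
  have \<tau>_in: "\<tau>1 \<in> P1" "\<tau>2 \<in> P2"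
    using T \<sigma> m1(1) m2(1) unfolding \<tau>1_def \<tau>2_def threshold_policies_def by blast+
  have \<tau>_vals: "\<tau>1 0 = \<sigma>1" "\<tau>1 1 = m1" "\<tau>2 0 = \<sigma>2" "\<tau>2 1 = m2"
    by (simp_all add: \<tau>1_def \<tau>2_def threshold_policy_def zero_ereal_def)
  have meta: "meta_payoff u D \<pi>1 \<pi>2 = payoff u (\<pi>1 (fst (f \<pi>1 \<pi>2))) (\<pi>2 (snd (f \<pi>1 \<pi>2)))"
    for \<pi>1 \<pi>2
    by (simp add: meta_payoff_def D_def)
  have "fst (meta_payoff u D \<pi>1 \<tau>2) \<le> fst (payoff u \<sigma>1 \<sigma>2)" if "\<pi>1 \<in> P1" for \<pi>1
  proof (cases "\<pi>1 = \<tau>1")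
    case False
    \<comment> \<open>The deviator also sees 1, so only her strategy there matters, and punishment
      holds every such strategy to the minimax payoff.\<close>
    have p: "\<pi>1 1 \<in> mixed A"
      using that P by (auto simp: policies_def)
    have "fst (payoff u (\<pi>1 1) m2) \<le> minimax1 A B u"
      unfolding fst_payoff[OF fin p m2(1)] by (rule mixed_payoff_le[OF fin(1) p m2(2)])
    also have "\<dots> \<le> fst (payoff u \<sigma>1 \<sigma>2)"
      using ir by (simp add: individually_rational_def)
    finally show ?thesis
      using False by (simp add: meta f_def \<tau>_vals)
  qed (simp add: meta f_def \<tau>_vals)
  moreover have "snd (meta_payoff u D \<tau>1 \<pi>2) \<le> snd (payoff u \<sigma>1 \<sigma>2)" if "\<pi>2 \<in> P2" for \<pi>2
  proof (cases "\<pi>2 = \<tau>2")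
    case False
    have q: "\<pi>2 1 \<in> mixed B"
      using that P by (auto simp: policies_def)
    have "snd (payoff u m1 (\<pi>2 1)) \<le> minimax2 A B u"
      unfolding snd_payoff[OF fin m1(1) q] by (rule mixed_payoff_le[OF fin(2) q m1(2)])
    also have "\<dots> \<le> snd (payoff u \<sigma>1 \<sigma>2)"
      using ir by (simp add: individually_rational_def)
    finally show ?thesis
      using False by (simp add: meta f_def \<tau>_vals)
  qed (simp add: meta f_def \<tau>_vals)
  ultimately have "meta_nash u P1 P2 D \<tau>1 \<tau>2"
    using \<tau>_in by (simp add: meta_nash_def meta[of \<tau>1 \<tau>2] f_def \<tau>_vals)
  moreover have "plays D \<tau>1 \<tau>2 \<sigma>1 \<sigma>2"
    by (simp add: plays_def D_def f_def \<tau>_vals)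
  moreover have "policy_diff_fun P1 P2 D"
    by (auto simp: policy_diff_fun_def D_def intro: prob_space_return)
  moreover have "deterministic P1 P2 D f"
    by (simp add: deterministic_def D_def)
  moreover have "\<forall>\<pi>1 \<pi>2. f \<pi>1 \<pi>2 \<in> {(0, 0), (1, 1)}"
    by (simp add: f_def)
  ultimately show ?thesis by blast
qed

theorem theorem3:
  fixes A1 :: "'a set" and A2 :: "'b set"
    and u :: "'a \<times> 'b \<Rightarrow> real \<times> real"
    and \<sigma>1 :: "'a pmf" and \<sigma>2 :: "'b pmf"
    and P1 :: "'a policy set" and P2 :: "'b policy set"
  assumes "finite A1" and "finite A2"
    and "\<sigma>1 \<in> mixed A1" and "\<sigma>2 \<in> mixed A2"
    and "P1 \<subseteq> policies A1" and "P2 \<subseteq> policies A2"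
    and "threshold_policies A1 \<subseteq> P1" and "threshold_policies A2 \<subseteq> P2"
  shows "((\<exists>D. policy_diff_fun P1 P2 D \<and>
             (\<exists>\<pi>1 \<pi>2. meta_nash u P1 P2 D \<pi>1 \<pi>2 \<and> plays D \<pi>1 \<pi>2 \<sigma>1 \<sigma>2 \<and>
                independent_play D \<pi>1 \<pi>2))
          \<longleftrightarrow> individually_rational A1 A2 u \<sigma>1 \<sigma>2)
       \<and> ((\<exists>D f. policy_diff_fun P1 P2 D \<and> deterministic P1 P2 D f \<and>
             (\<forall>\<pi>1\<in>P1. \<forall>\<pi>2\<in>P2. fst (f \<pi>1 \<pi>2) = snd (f \<pi>1 \<pi>2) \<and>
                fst (f \<pi>1 \<pi>2) \<in> {0, 1} \<and> snd (f \<pi>1 \<pi>2) \<in> {0, 1}) \<and>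
             (\<exists>\<pi>1 \<pi>2. meta_nash u P1 P2 D \<pi>1 \<pi>2 \<and> plays D \<pi>1 \<pi>2 \<sigma>1 \<sigma>2))
          \<longleftrightarrow> individually_rational A1 A2 u \<sigma>1 \<sigma>2)"
proof (intro conjI iffI)
  show "individually_rational A1 A2 u \<sigma>1 \<sigma>2"
    if "\<exists>D. policy_diff_fun P1 P2 D \<and> (\<exists>\<pi>1 \<pi>2. meta_nash u P1 P2 D \<pi>1 \<pi>2 \<and>
      plays D \<pi>1 \<pi>2 \<sigma>1 \<sigma>2 \<and> independent_play D \<pi>1 \<pi>2)"
    using that individually_rational_of_meta_nash[OF assms] by blast
next
  \<comment> \<open>Independence is automatic for a point mass, so this case reduces to the general
    one.\<close>
  show "individually_rational A1 A2 u \<sigma>1 \<sigma>2"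
    if "\<exists>D f. policy_diff_fun P1 P2 D \<and> deterministic P1 P2 D f \<and>
      (\<forall>\<pi>1\<in>P1. \<forall>\<pi>2\<in>P2. fst (f \<pi>1 \<pi>2) = snd (f \<pi>1 \<pi>2) \<and>
        fst (f \<pi>1 \<pi>2) \<in> {0, 1} \<and> snd (f \<pi>1 \<pi>2) \<in> {0, 1}) \<and>
      (\<exists>\<pi>1 \<pi>2. meta_nash u P1 P2 D \<pi>1 \<pi>2 \<and> plays D \<pi>1 \<pi>2 \<sigma>1 \<sigma>2)"
    using that individually_rational_of_meta_nash[OF assms] deterministic_independent_play
    unfolding meta_nash_def by blast
next
  \<comment> \<open>One deterministic construction witnesses both remaining implications.\<close>
  assume "individually_rational A1 A2 u \<sigma>1 \<sigma>2"
  then obtain D f \<pi>1 \<pi>2 where D: "policy_diff_fun P1 P2 D" "deterministic P1 P2 D f"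
    and f: "\<And>\<pi>1 \<pi>2. f \<pi>1 \<pi>2 \<in> {(0, 0), (1, 1)}"
    and nash: "meta_nash u P1 P2 D \<pi>1 \<pi>2" "plays D \<pi>1 \<pi>2 \<sigma>1 \<sigma>2"
    using meta_nash_of_individually_rational[OF assms] by blast
  have "independent_play D \<pi>1 \<pi>2"
    using deterministic_independent_play[OF D(2)] nash(1) by (simp add: meta_nash_def)
  with D nash show "\<exists>D. policy_diff_fun P1 P2 D \<and> (\<exists>\<pi>1 \<pi>2. meta_nash u P1 P2 D \<pi>1 \<pi>2 \<and>
      plays D \<pi>1 \<pi>2 \<sigma>1 \<sigma>2 \<and> independent_play D \<pi>1 \<pi>2)"
    by blast
  have "\<forall>\<pi>1\<in>P1. \<forall>\<pi>2\<in>P2. fst (f \<pi>1 \<pi>2) = snd (f \<pi>1 \<pi>2) \<and>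
      fst (f \<pi>1 \<pi>2) \<in> {0, 1} \<and> snd (f \<pi>1 \<pi>2) \<in> {0, 1}"
  proof (intro ballI)
    fix \<pi>1 \<pi>2
    show "fst (f \<pi>1 \<pi>2) = snd (f \<pi>1 \<pi>2) \<and>
        fst (f \<pi>1 \<pi>2) \<in> {0, 1} \<and> snd (f \<pi>1 \<pi>2) \<in> {0, 1}"
      using f[of \<pi>1 \<pi>2] by auto
  qed
  with D nash show "\<exists>D f. policy_diff_fun P1 P2 D \<and> deterministic P1 P2 D f \<and>
      (\<forall>\<pi>1\<in>P1. \<forall>\<pi>2\<in>P2. fst (f \<pi>1 \<pi>2) = snd (f \<pi>1 \<pi>2) \<and>
        fst (f \<pi>1 \<pi>2) \<in> {0, 1} \<and> snd (f \<pi>1 \<pi>2) \<in> {0, 1}) \<and>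
      (\<exists>\<pi>1 \<pi>2. meta_nash u P1 P2 D \<pi>1 \<pi>2 \<and> plays D \<pi>1 \<pi>2 \<sigma>1 \<sigma>2)"
    by blast
qed

end
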